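(* Let $(G,s_G,t_G)$ and $(X,s_X,t_X)$ be two crossed modules, and consider their binary coproduct $(G+_{\mathrm{XMod}}X,\ \overline{s_G+s_X},\ \overline{t_G+t_X})$ in the category $\mathrm{XMod}$ of crossed modules. For a morphism $f\colon G\to X$ of crossed modules, the kernel in $\mathrm{XMod}$ of the induced morphism $\overline{\langle f,1_X\rangle}\colon G+_{\mathrm{XMod}}X\to X$ is the crossed module $$\left(\frac{\mathrm{Ker}(\langle f,1_X\rangle)_{\mathrm{Grp}}}{[\mathrm{Ker}(s_G+s_X),\mathrm{Ker}(t_G+t_X)]},\ s_{\mathrm{XMod}},\ t_{\mathrm{XMod}}\right),$$ where $\mathrm{Ker}(\langle f,1_X\rangle)_{\mathrm{Grp}}$ is the kernel of the group homomorphism $\langle f,1_X\rangle\colon G+X\to X$, and $s_{\mathrm{XMod}}$, $t_{\mathrm{XMod}}$ are the morphisms induced on this quotient by $\overline{s_G+s_X}$ and $\overline{t_G+t_X}$ respectively.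
   Context: A precrossed module (over groups) is viewed as a triple $(G,s,t)$ with $G$ a group and $s,t\colon G\to G$ group endomorphisms with $ts=s$ and $st=t$; it is a crossed module if moreover $[\mathrm{Ker}(s),\mathrm{Ker}(t)]$ is trivial (usual commutator of subgroups). Morphisms are group homomorphisms commuting with $s$ and $t$. $G+X$ is the coproduct (free product) of groups, $s_G+s_X$ and $t_G+t_X$ are the induced endomorphisms of $G+X$, and $\langle f,1_X\rangle\colon G+X\to X$ is the homomorphism equal to $f$ on $G$ and to $1_X$ on $X$. The binary coproduct in $\mathrm{XMod}$ has underlying group $G+_{\mathrm{XMod}}X=\frac{G+X}{[\mathrm{Ker}(s_G+s_X),\mathrm{Ker}(t_G+t_X)]}$, with quotient map $q\colon G+X\to G+_{\mathrm{XMod}}X$; $\overline{s_G+s_X}$ and $\overline{t_G+t_X}$ are the unique endomorphisms with $\overline{s_G+s_X}\,q=q(s_G+s_X)$ and $\overline{t_G+t_X}\,q=q(t_G+t_X)$; and the coproduct inclusions are those of $G+X$ followed by $q$. The morphism $\overline{\langle f,1_X\rangle}$ is the unique one with $\overline{\langle f,1_X\rangle}\,q=\langle f,1_X\rangle$. *)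

theory Defs
  imports "HOL-Algebra.Generated_Groups"
begin

section \<open>Crossed modules as triples \<open>(G, s, t)\<close>\<close>

type_synonym 'a gtriple = "'a monoid \<times> ('a \<Rightarrow> 'a) \<times> ('a \<Rightarrow> 'a)"

definition commutator_subgroup :: "('a, 'b) monoid_scheme \<Rightarrow> 'a set \<Rightarrow> 'a set \<Rightarrow> 'a set" where
  "commutator_subgroup G H K =
     generate G {h \<otimes>\<^bsub>G\<^esub> k \<otimes>\<^bsub>G\<^esub> inv\<^bsub>G\<^esub> h \<otimes>\<^bsub>G\<^esub> inv\<^bsub>G\<^esub> k | h k. h \<in> H \<and> k \<in> K}"

fun precrossed_module :: "'a gtriple \<Rightarrow> bool" where
  "precrossed_module (G, s, t) \<longleftrightarrow>
     group G \<and> s \<in> hom G G \<and> t \<in> hom G G \<and>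
     (\<forall>x\<in>carrier G. t (s x) = s x) \<and> (\<forall>x\<in>carrier G. s (t x) = t x)"

fun crossed_module :: "'a gtriple \<Rightarrow> bool" where
  "crossed_module (G, s, t) \<longleftrightarrow>
     precrossed_module (G, s, t) \<and>
     commutator_subgroup G (kernel G G s) (kernel G G t) = {\<one>\<^bsub>G\<^esub>}"

fun xmod_hom :: "'a gtriple \<Rightarrow> 'b gtriple \<Rightarrow> ('a \<Rightarrow> 'b) set" where
  "xmod_hom (G, s, t) (H, s', t') =
     {f \<in> hom G H. \<forall>x\<in>carrier G. f (s x) = s' (f x) \<and> f (t x) = t' (f x)}"

text \<open>
  The categorical kernel in XMod: \<open>k : K \<rightarrow> A\<close> is universal among the morphisms of crossed
  modules that become trivial after composition with \<open>\<phi> : A \<rightarrow> B\<close>.  HOL cannot quantify over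
  types inside a formula, so the type of the test objects \<open>Z\<close> is a parameter; a theorem that
  leaves \<open>'z\<close> free asserts the universal property for test objects of every type.  Morphisms
  are compared on carriers only.
\<close>

definition is_xmod_kernel ::
    "'z itself \<Rightarrow> 'a gtriple \<Rightarrow> 'b gtriple \<Rightarrow> ('a \<Rightarrow> 'b) \<Rightarrow> 'k gtriple \<Rightarrow> ('k \<Rightarrow> 'a) \<Rightarrow> bool" where
  "is_xmod_kernel _ A B \<phi> K k \<longleftrightarrow>
     crossed_module A \<and> crossed_module B \<and> \<phi> \<in> xmod_hom A B \<and>
     crossed_module K \<and> k \<in> xmod_hom K A \<and>
     (\<forall>x\<in>carrier (fst K). \<phi> (k x) = \<one>\<^bsub>fst B\<^esub>) \<and>
     (\<forall>(Z :: 'z gtriple) h.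
        crossed_module Z \<longrightarrow> h \<in> xmod_hom Z A \<longrightarrow>
        (\<forall>z\<in>carrier (fst Z). \<phi> (h z) = \<one>\<^bsub>fst B\<^esub>) \<longrightarrow>
        (\<exists>u\<in>xmod_hom Z K.
           (\<forall>z\<in>carrier (fst Z). k (u z) = h z) \<and>
           (\<forall>v\<in>xmod_hom Z K. (\<forall>z\<in>carrier (fst Z). k (v z) = h z) \<longrightarrow>
              (\<forall>z\<in>carrier (fst Z). v z = u z))))"

definition is_xmod_coproduct ::
    "'z itself \<Rightarrow> 'a gtriple \<Rightarrow> 'b gtriple \<Rightarrow> 'c gtriple \<Rightarrow> ('a \<Rightarrow> 'c) \<Rightarrow> ('b \<Rightarrow> 'c) \<Rightarrow> bool" where
  "is_xmod_coproduct _ A B C i j \<longleftrightarrow>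
     crossed_module A \<and> crossed_module B \<and> crossed_module C \<and>
     i \<in> xmod_hom A C \<and> j \<in> xmod_hom B C \<and>
     (\<forall>(Z :: 'z gtriple) f g.
        crossed_module Z \<longrightarrow> f \<in> xmod_hom A Z \<longrightarrow> g \<in> xmod_hom B Z \<longrightarrow>
        (\<exists>u\<in>xmod_hom C Z.
           (\<forall>a\<in>carrier (fst A). u (i a) = f a) \<and> (\<forall>b\<in>carrier (fst B). u (j b) = g b) \<and>
           (\<forall>v\<in>xmod_hom C Z.
              (\<forall>a\<in>carrier (fst A). v (i a) = f a) \<longrightarrow> (\<forall>b\<in>carrier (fst B). v (j b) = g b) \<longrightarrow>
              (\<forall>c\<in>carrier (fst C). v c = u c))))"


section \<open>Free products of groups\<close>

text \<open>The congruence on words over the disjoint union of the carriers that identifies adjacent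
  letters from the same factor with their product and the units with the empty word.\<close>

inductive word_eq :: "'a monoid \<Rightarrow> 'b monoid \<Rightarrow> ('a + 'b) list \<Rightarrow> ('a + 'b) list \<Rightarrow> bool"
  for G :: "'a monoid" and X :: "'b monoid" where
  refl: "w \<in> lists (carrier G <+> carrier X) \<Longrightarrow> word_eq G X w w"
| sym: "word_eq G X u v \<Longrightarrow> word_eq G X v u"
| trans: "word_eq G X u v \<Longrightarrow> word_eq G X v w \<Longrightarrow> word_eq G X u w"
| append: "word_eq G X u u' \<Longrightarrow> word_eq G X v v' \<Longrightarrow> word_eq G X (u @ v) (u' @ v')"
| mult_left: "a \<in> carrier G \<Longrightarrow> b \<in> carrier G \<Longrightarrow> word_eq G X [Inl a, Inl b] [Inl (a \<otimes>\<^bsub>G\<^esub> b)]"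
| mult_right: "x \<in> carrier X \<Longrightarrow> y \<in> carrier X \<Longrightarrow> word_eq G X [Inr x, Inr y] [Inr (x \<otimes>\<^bsub>X\<^esub> y)]"
| one_left: "word_eq G X [Inl \<one>\<^bsub>G\<^esub>] []"
| one_right: "word_eq G X [Inr \<one>\<^bsub>X\<^esub>] []"

definition word_class :: "'a monoid \<Rightarrow> 'b monoid \<Rightarrow> ('a + 'b) list \<Rightarrow> ('a + 'b) list set" where
  "word_class G X w = {v. word_eq G X w v}"

definition free_prod :: "'a monoid \<Rightarrow> 'b monoid \<Rightarrow> ('a + 'b) list set monoid" where
  "free_prod G X =
     \<lparr>carrier = word_class G X ` lists (carrier G <+> carrier X),
      mult = (\<lambda>A B. \<Union>u\<in>A. \<Union>v\<in>B. word_class G X (u @ v)),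
      one = word_class G X []\<rparr>"

definition fp_inl :: "'a monoid \<Rightarrow> 'b monoid \<Rightarrow> 'a \<Rightarrow> ('a + 'b) list set" where
  "fp_inl G X a = word_class G X [Inl a]"

definition fp_inr :: "'a monoid \<Rightarrow> 'b monoid \<Rightarrow> 'b \<Rightarrow> ('a + 'b) list set" where
  "fp_inr G X x = word_class G X [Inr x]"

text \<open>The map induced by \<open>h\<close> on classes (word classes or cosets) on which \<open>h\<close> is constant.\<close>

definition class_lift :: "('a \<Rightarrow> 'b) \<Rightarrow> 'a set \<Rightarrow> 'b" where
  "class_lift h A = the_elem (h ` A)"

definition word_eval :: "('c, 'd) monoid_scheme \<Rightarrow> ('a \<Rightarrow> 'c) \<Rightarrow> ('b \<Rightarrow> 'c) \<Rightarrow> ('a + 'b) list \<Rightarrow> 'c" where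
  "word_eval H f g w = foldr (\<lambda>l r. case_sum f g l \<otimes>\<^bsub>H\<^esub> r) w \<one>\<^bsub>H\<^esub>"

text \<open>\<open>copair H f g\<close> is \<open>\<langle>f, g\<rangle> : G + X \<rightarrow> H\<close>; \<open>fp_map G X a b\<close> is \<open>a + b : G + X \<rightarrow> G + X\<close>.\<close>

definition copair :: "('c, 'd) monoid_scheme \<Rightarrow> ('a \<Rightarrow> 'c) \<Rightarrow> ('b \<Rightarrow> 'c) \<Rightarrow> ('a + 'b) list set \<Rightarrow> 'c" where
  "copair H f g = class_lift (word_eval H f g)"

definition fp_map ::
    "'a monoid \<Rightarrow> 'b monoid \<Rightarrow> ('a \<Rightarrow> 'a) \<Rightarrow> ('b \<Rightarrow> 'b) \<Rightarrow> ('a + 'b) list set \<Rightarrow> ('a + 'b) list set" where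
  "fp_map G X a b = copair (free_prod G X) (fp_inl G X \<circ> a) (fp_inr G X \<circ> b)"


section \<open>The binary coproduct of crossed modules\<close>

fun precrossed_coprod :: "'a gtriple \<Rightarrow> 'b gtriple \<Rightarrow> ('a + 'b) list set gtriple" where
  "precrossed_coprod (G, sG, tG) (X, sX, tX) =
     (free_prod G X, fp_map G X sG sX, fp_map G X tG tX)"

fun peiffer :: "'a gtriple \<Rightarrow> 'a set" where
  "peiffer (P, s, t) = commutator_subgroup P (kernel P P s) (kernel P P t)"

text \<open>The second and third components are the maps induced on the quotient by \<open>q \<circ> s\<close> and \<open>q \<circ> t\<close>,
  where \<open>q\<close> is the quotient map.\<close>

fun peiffer_quot :: "'a gtriple \<Rightarrow> 'a set gtriple" where
  "peiffer_quot (P, s, t) =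
     (P Mod peiffer (P, s, t),
      class_lift (\<lambda>a. peiffer (P, s, t) #>\<^bsub>P\<^esub> s a),
      class_lift (\<lambda>a. peiffer (P, s, t) #>\<^bsub>P\<^esub> t a))"

definition xmod_coprod :: "'a gtriple \<Rightarrow> 'b gtriple \<Rightarrow> ('a + 'b) list set set gtriple" where
  "xmod_coprod A B = peiffer_quot (precrossed_coprod A B)"


section \<open>Universal properties of the constructions\<close>

subsection \<open>Free products\<close>

context
  fixes G :: "'a monoid" and X :: "'b monoid"
  assumes G: "group G" and X: "group X"
begin

interpretation G: group G by (rule G)
interpretation X: group X by (rule X)

lemma word_eq_lists:
  "word_eq G X u v \<Longrightarrow> u \<in> lists (carrier G <+> carrier X) \<and> v \<in> lists (carrier G <+> carrier X)"
  by (induction rule: word_eq.induct) auto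

lemma word_class_eq_iff:
  assumes "u \<in> lists (carrier G <+> carrier X)"
  shows "word_class G X u = word_class G X v \<longleftrightarrow> word_eq G X u v"
proof
  assume "word_class G X u = word_class G X v"
  moreover have "u \<in> word_class G X u"
    using assms by (simp add: word_class_def word_eq.refl)
  ultimately show "word_eq G X u v"
    by (simp add: word_class_def word_eq.sym)
next
  assume uv: "word_eq G X u v"
  show "word_class G X u = word_class G X v"
    unfolding word_class_def
    using word_eq.trans[OF uv] word_eq.trans[OF word_eq.sym[OF uv]] by blast
qed

lemma word_class_self: "w \<in> lists (carrier G <+> carrier X) \<Longrightarrow> w \<in> word_class G X w"
  by (simp add: word_class_def word_eq.refl)

lemma free_prod_mult_class:
  assumes "u \<in> lists (carrier G <+> carrier X)" "v \<in> lists (carrier G <+> carrier X)"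
  shows "word_class G X u \<otimes>\<^bsub>free_prod G X\<^esub> word_class G X v = word_class G X (u @ v)"
proof -
  have const: "word_class G X (u' @ v') = word_class G X (u @ v)"
    if "u' \<in> word_class G X u" "v' \<in> word_class G X v" for u' v'
  proof -
    have "word_eq G X u u'" "word_eq G X v v'"
      using that by (simp_all add: word_class_def)
    then have "word_eq G X (u @ v) (u' @ v')"
      by (rule word_eq.append)
    moreover have "u @ v \<in> lists (carrier G <+> carrier X)"
      using assms by simp
    ultimately show ?thesis
      using word_class_eq_iff[of "u @ v" "u' @ v'"] by simp
  qed
  have "(\<Union>u'\<in>word_class G X u. \<Union>v'\<in>word_class G X v. word_class G X (u' @ v')) =
      (\<Union>u'\<in>word_class G X u. \<Union>v'\<in>word_class G X v. word_class G X (u @ v))"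
    by (intro SUP_cong HOL.refl const)
  also have "\<dots> = word_class G X (u @ v)"
    using word_class_self[OF assms(1)] word_class_self[OF assms(2)] by blast
  finally show ?thesis
    by (simp add: free_prod_def)
qed

lemma word_eq_inverse:
  assumes "w \<in> lists (carrier G <+> carrier X)"
  shows "\<exists>v\<in>lists (carrier G <+> carrier X). word_eq G X (v @ w) []"
  using assms
proof (induction w)
  case Nil
  then show ?case by (intro bexI[of _ "[]"]) (simp_all add: word_eq.refl)
next
  case (Cons l w)
  then obtain v where v: "v \<in> lists (carrier G <+> carrier X)" "word_eq G X (v @ w) []"
    by auto
  obtain l' where l': "l' \<in> carrier G <+> carrier X" "word_eq G X [l', l] []"
  proof -
    have "l \<in> carrier G <+> carrier X"
      using Cons.hyps by simp
    then consider a where "l = Inl a" "a \<in> carrier G" | x where "l = Inr x" "x \<in> carrier X"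
      by blast
    then show thesis
    proof cases
      case 1
      then have "word_eq G X [Inl (inv\<^bsub>G\<^esub> a), Inl a] [Inl \<one>\<^bsub>G\<^esub>]"
        using word_eq.mult_left[of "inv\<^bsub>G\<^esub> a" G a X] by simp
      then have "word_eq G X [Inl (inv\<^bsub>G\<^esub> a), Inl a] []"
        by (rule word_eq.trans) (rule word_eq.one_left)
      with 1 that[of "Inl (inv\<^bsub>G\<^esub> a)"] show thesis by auto
    next
      case 2
      then have "word_eq G X [Inr (inv\<^bsub>X\<^esub> x), Inr x] [Inr \<one>\<^bsub>X\<^esub>]"
        using word_eq.mult_right[of "inv\<^bsub>X\<^esub> x" X x G] by simp
      then have "word_eq G X [Inr (inv\<^bsub>X\<^esub> x), Inr x] []"
        by (rule word_eq.trans) (rule word_eq.one_right)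
      with 2 that[of "Inr (inv\<^bsub>X\<^esub> x)"] show thesis by auto
    qed
  qed
  have w: "word_eq G X w w" and vv: "word_eq G X v v"
    using Cons.hyps v by (auto intro: word_eq.refl)
  have "word_eq G X (v @ ([l', l] @ w)) (v @ ([] @ w))"
    by (intro word_eq.append vv w l')
  then have "word_eq G X ((v @ [l']) @ (l # w)) (v @ w)" by simp
  then have "word_eq G X ((v @ [l']) @ (l # w)) []"
    using v(2) by (rule word_eq.trans)
  moreover have "v @ [l'] \<in> lists (carrier G <+> carrier X)"
    using v l' by auto
  ultimately show ?case by blast
qed

lemma carrier_free_prod:
  "carrier (free_prod G X) = word_class G X ` lists (carrier G <+> carrier X)"
  by (simp add: free_prod_def)

lemma free_prodE:
  assumes "A \<in> carrier (free_prod G X)"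
  obtains w where "A = word_class G X w" "w \<in> lists (carrier G <+> carrier X)"
  using assms unfolding carrier_free_prod by (rule imageE)

lemma one_free_prod: "\<one>\<^bsub>free_prod G X\<^esub> = word_class G X []"
  by (simp add: free_prod_def)

lemma free_prod_group: "group (free_prod G X)"
proof (rule groupI)
  show "\<one>\<^bsub>free_prod G X\<^esub> \<in> carrier (free_prod G X)"
    unfolding carrier_free_prod one_free_prod by blast
next
  fix A B
  assume "A \<in> carrier (free_prod G X)" "B \<in> carrier (free_prod G X)"
  then obtain u v where "A = word_class G X u" "B = word_class G X v"
    "u \<in> lists (carrier G <+> carrier X)" "v \<in> lists (carrier G <+> carrier X)"
    by (elim free_prodE)
  then show "A \<otimes>\<^bsub>free_prod G X\<^esub> B \<in> carrier (free_prod G X)"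
    by (simp add: carrier_free_prod free_prod_mult_class)
next
  fix A B C
  assume "A \<in> carrier (free_prod G X)" "B \<in> carrier (free_prod G X)" "C \<in> carrier (free_prod G X)"
  then obtain u v w where
    "A = word_class G X u" "B = word_class G X v" "C = word_class G X w"
    "u \<in> lists (carrier G <+> carrier X)" "v \<in> lists (carrier G <+> carrier X)"
    "w \<in> lists (carrier G <+> carrier X)"
    by (elim free_prodE)
  then show "A \<otimes>\<^bsub>free_prod G X\<^esub> B \<otimes>\<^bsub>free_prod G X\<^esub> C
      = A \<otimes>\<^bsub>free_prod G X\<^esub> (B \<otimes>\<^bsub>free_prod G X\<^esub> C)"
    by (simp add: free_prod_mult_class)
next
  fix A
  assume "A \<in> carrier (free_prod G X)"
  then show "\<one>\<^bsub>free_prod G X\<^esub> \<otimes>\<^bsub>free_prod G X\<^esub> A = A"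
    using free_prod_mult_class[OF lists.Nil] by (auto simp: carrier_free_prod one_free_prod)
next
  fix A
  assume "A \<in> carrier (free_prod G X)"
  then obtain w where w: "A = word_class G X w" "w \<in> lists (carrier G <+> carrier X)"
    by (elim free_prodE)
  obtain v where v: "v \<in> lists (carrier G <+> carrier X)" "word_eq G X (v @ w) []"
    using word_eq_inverse[OF w(2)] by blast
  have "word_class G X v \<otimes>\<^bsub>free_prod G X\<^esub> A = \<one>\<^bsub>free_prod G X\<^esub>"
    using v w free_prod_mult_class[of v w] word_class_eq_iff[of "v @ w" "[]"]
    by (simp add: one_free_prod)
  with v show "\<exists>B\<in>carrier (free_prod G X). B \<otimes>\<^bsub>free_prod G X\<^esub> A = \<one>\<^bsub>free_prod G X\<^esub>"
    unfolding carrier_free_prod by blast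
qed

lemma fp_inl_hom: "fp_inl G X \<in> hom G (free_prod G X)"
proof (rule homI)
  show "fp_inl G X a \<in> carrier (free_prod G X)" if "a \<in> carrier G" for a
    using that unfolding carrier_free_prod fp_inl_def by (intro imageI) auto
  show "fp_inl G X (a \<otimes>\<^bsub>G\<^esub> b) = fp_inl G X a \<otimes>\<^bsub>free_prod G X\<^esub> fp_inl G X b"
    if "a \<in> carrier G" "b \<in> carrier G" for a b
    using that free_prod_mult_class[of "[Inl a]" "[Inl b]"]
      word_class_eq_iff[of "[Inl a, Inl b]" "[Inl (a \<otimes>\<^bsub>G\<^esub> b)]"] word_eq.mult_left[of a G b X]
    by (auto simp: fp_inl_def)
qed

lemma fp_inr_hom: "fp_inr G X \<in> hom X (free_prod G X)"
proof (rule homI)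
  show "fp_inr G X x \<in> carrier (free_prod G X)" if "x \<in> carrier X" for x
    using that unfolding carrier_free_prod fp_inr_def by (intro imageI) auto
  show "fp_inr G X (x \<otimes>\<^bsub>X\<^esub> y) = fp_inr G X x \<otimes>\<^bsub>free_prod G X\<^esub> fp_inr G X y"
    if "x \<in> carrier X" "y \<in> carrier X" for x y
    using that free_prod_mult_class[of "[Inr x]" "[Inr y]"]
      word_class_eq_iff[of "[Inr x, Inr y]" "[Inr (x \<otimes>\<^bsub>X\<^esub> y)]"] word_eq.mult_right[of x X y G]
    by (auto simp: fp_inr_def)
qed

lemma free_prod_induct [consumes 1, case_names one inl inr]:
  assumes A: "A \<in> carrier (free_prod G X)"
    and one: "Q \<one>\<^bsub>free_prod G X\<^esub>"
    and inl: "\<And>a B. a \<in> carrier G \<Longrightarrow> B \<in> carrier (free_prod G X) \<Longrightarrow> Q B \<Longrightarrow>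
      Q (fp_inl G X a \<otimes>\<^bsub>free_prod G X\<^esub> B)"
    and inr: "\<And>x B. x \<in> carrier X \<Longrightarrow> B \<in> carrier (free_prod G X) \<Longrightarrow> Q B \<Longrightarrow>
      Q (fp_inr G X x \<otimes>\<^bsub>free_prod G X\<^esub> B)"
  shows "Q A"
proof -
  have "Q (word_class G X w)" if "w \<in> lists (carrier G <+> carrier X)" for w
    using that
  proof (induction w)
    case Nil
    then show ?case using one by (simp add: one_free_prod)
  next
    case (Cons l w)
    then have w: "w \<in> lists (carrier G <+> carrier X)" and Q: "Q (word_class G X w)" by auto
    have c: "word_class G X w \<in> carrier (free_prod G X)"
      using w by (simp add: carrier_free_prod)
    have e: "word_class G X (l # w) = word_class G X [l] \<otimes>\<^bsub>free_prod G X\<^esub> word_class G X w"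
      using free_prod_mult_class[of "[l]" w] Cons.hyps by simp
    show ?case
    proof (cases l)
      case (Inl a)
      with Cons.hyps have a: "a \<in> carrier G" by auto
      with inl[OF a c Q] e Inl show ?thesis by (simp add: fp_inl_def)
    next
      case (Inr x)
      with Cons.hyps have x: "x \<in> carrier X" by auto
      with inr[OF x c Q] e Inr show ?thesis by (simp add: fp_inr_def)
    qed
  qed
  with A show ?thesis by (auto simp: carrier_free_prod)
qed

context
  fixes H :: "('c, 'd) monoid_scheme" and f :: "'a \<Rightarrow> 'c" and g :: "'b \<Rightarrow> 'c"
  assumes H: "group H" and f: "f \<in> hom G H" and g: "g \<in> hom X H"
begin

interpretation H: group H by (rule H)
interpretation f: group_hom G H f by unfold_locales (rule f)
interpretation g: group_hom X H g by unfold_locales (rule g)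

lemma word_eval_closed:
  "w \<in> lists (carrier G <+> carrier X) \<Longrightarrow> word_eval H f g w \<in> carrier H"
  by (induction w) (auto simp: word_eval_def)

lemma word_eval_append:
  assumes "u \<in> lists (carrier G <+> carrier X)" "v \<in> lists (carrier G <+> carrier X)"
  shows "word_eval H f g (u @ v) = word_eval H f g u \<otimes>\<^bsub>H\<^esub> word_eval H f g v"
  using assms(1)
proof (induction u)
  case Nil
  then show ?case using word_eval_closed[OF assms(2)] by (simp add: word_eval_def)
next
  case (Cons l u)
  have 1: "word_eval H f g (l # w) = case_sum f g l \<otimes>\<^bsub>H\<^esub> word_eval H f g w" for w
    by (simp add: word_eval_def)
  have "case_sum f g l \<in> carrier H" using Cons.hyps by auto
  with Cons word_eval_closed[OF assms(2)] word_eval_closed[of u] show ?case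
    by (simp add: 1 H.m_assoc)
qed

lemma word_eval_cong:
  "word_eq G X u v \<Longrightarrow> word_eval H f g u = word_eval H f g v"
proof (induction rule: word_eq.induct)
  case (append u u' v v')
  then show ?case
    using word_eq_lists[OF append(1)] word_eq_lists[OF append(2)] by (simp add: word_eval_append)
qed (auto simp: word_eval_def)

lemma copair_class:
  assumes "w \<in> lists (carrier G <+> carrier X)"
  shows "copair H f g (word_class G X w) = word_eval H f g w"
proof -
  have "word_eval H f g v = word_eval H f g w" if "v \<in> word_class G X w" for v
    using that word_eval_cong[of w v] by (simp add: word_class_def)
  then have "word_eval H f g ` word_class G X w = (\<lambda>_. word_eval H f g w) ` word_class G X w"
    by (intro image_cong HOL.refl)
  also have "\<dots> = {word_eval H f g w}"
    using word_class_self[OF assms] by (rule image_constant)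
  finally have "word_eval H f g ` word_class G X w = {word_eval H f g w}" .
  then show ?thesis by (simp add: copair_def class_lift_def)
qed

lemma copair_hom: "copair H f g \<in> hom (free_prod G X) H"
proof (rule homI)
  show "copair H f g A \<in> carrier H" if "A \<in> carrier (free_prod G X)" for A
    using that unfolding carrier_free_prod by (elim imageE) (simp add: copair_class word_eval_closed)
  show "copair H f g (A \<otimes>\<^bsub>free_prod G X\<^esub> B) = copair H f g A \<otimes>\<^bsub>H\<^esub> copair H f g B"
    if AB: "A \<in> carrier (free_prod G X)" "B \<in> carrier (free_prod G X)" for A B
  proof -
    obtain u v where "A = word_class G X u" "B = word_class G X v"
      and u: "u \<in> lists (carrier G <+> carrier X)" and v: "v \<in> lists (carrier G <+> carrier X)"
      using AB by (elim free_prodE)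
    moreover have "u @ v \<in> lists (carrier G <+> carrier X)" using u v by simp
    ultimately show ?thesis
      by (simp only: free_prod_mult_class[OF u v] copair_class word_eval_append[OF u v])
  qed
qed

lemma copair_inl: "a \<in> carrier G \<Longrightarrow> copair H f g (fp_inl G X a) = f a"
  using copair_class[of "[Inl a]"] InlI[of a "carrier G" "carrier X"]
  by (simp add: fp_inl_def word_eval_def)

lemma copair_inr: "x \<in> carrier X \<Longrightarrow> copair H f g (fp_inr G X x) = g x"
  using copair_class[of "[Inr x]"] InrI[of x "carrier X" "carrier G"]
  by (simp add: fp_inr_def word_eval_def)

end

lemma free_prod_hom_eq:
  assumes H: "group H" and h: "h \<in> hom (free_prod G X) H" and k: "k \<in> hom (free_prod G X) H"
    and l: "\<And>a. a \<in> carrier G \<Longrightarrow> h (fp_inl G X a) = k (fp_inl G X a)"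
    and r: "\<And>x. x \<in> carrier X \<Longrightarrow> h (fp_inr G X x) = k (fp_inr G X x)"
    and A: "A \<in> carrier (free_prod G X)"
  shows "h A = k A"
  using A
proof (induction rule: free_prod_induct)
  case one
  show ?case using hom_one[OF h free_prod_group H] hom_one[OF k free_prod_group H] by simp
next
  case (inl a B)
  moreover have "fp_inl G X a \<in> carrier (free_prod G X)"
    using inl fp_inl_hom by (auto simp: hom_def)
  ultimately show ?case using h k l by (simp add: hom_mult)
next
  case (inr x B)
  moreover have "fp_inr G X x \<in> carrier (free_prod G X)"
    using inr fp_inr_hom by (auto simp: hom_def)
  ultimately show ?case using h k r by (simp add: hom_mult)
qed

lemma fp_map_hom:
  assumes "a \<in> hom G G" "b \<in> hom X X"
  shows "fp_map G X a b \<in> hom (free_prod G X) (free_prod G X)"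
  unfolding fp_map_def
  by (rule copair_hom[OF free_prod_group]) (rule hom_compose assms fp_inl_hom fp_inr_hom)+

lemma fp_map_inl:
  assumes "a \<in> hom G G" "b \<in> hom X X" "u \<in> carrier G"
  shows "fp_map G X a b (fp_inl G X u) = fp_inl G X (a u)"
  unfolding fp_map_def
  using copair_inl[OF free_prod_group hom_compose[OF assms(1) fp_inl_hom]
      hom_compose[OF assms(2) fp_inr_hom] assms(3)]
  by simp

lemma fp_map_inr:
  assumes "a \<in> hom G G" "b \<in> hom X X" "x \<in> carrier X"
  shows "fp_map G X a b (fp_inr G X x) = fp_inr G X (b x)"
  unfolding fp_map_def
  using copair_inr[OF free_prod_group hom_compose[OF assms(1) fp_inl_hom]
      hom_compose[OF assms(2) fp_inr_hom] assms(3)]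
  by simp

end

lemma precrossed_module_coprod:
  assumes "precrossed_module (G, sG, tG)" "precrossed_module (X, sX, tX)"
  shows "precrossed_module (precrossed_coprod (G, sG, tG) (X, sX, tX))"
proof -
  have G: "group G" "sG \<in> hom G G" "tG \<in> hom G G"
      "\<And>x. x \<in> carrier G \<Longrightarrow> tG (sG x) = sG x" "\<And>x. x \<in> carrier G \<Longrightarrow> sG (tG x) = tG x"
    and X: "group X" "sX \<in> hom X X" "tX \<in> hom X X"
      "\<And>x. x \<in> carrier X \<Longrightarrow> tX (sX x) = sX x" "\<And>x. x \<in> carrier X \<Longrightarrow> sX (tX x) = tX x"
    using assms by auto
  note hG = hom_in_carrier[OF G(2)] hom_in_carrier[OF G(3)]
  note hX = hom_in_carrier[OF X(2)] hom_in_carrier[OF X(3)]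
  note grp = free_prod_group[OF G(1) X(1)]
  note map = fp_map_hom[OF G(1) X(1)]
  note hs = map[OF G(2) X(2)] and ht = map[OF G(3) X(3)]
  note ev = fp_map_inl[OF G(1) X(1) G(2) X(2)] fp_map_inr[OF G(1) X(1) G(2) X(2)]
    fp_map_inl[OF G(1) X(1) G(3) X(3)] fp_map_inr[OF G(1) X(1) G(3) X(3)]
  have "(fp_map G X tG tX \<circ> fp_map G X sG sX) A = fp_map G X sG sX A"
    if "A \<in> carrier (free_prod G X)" for A
    by (rule free_prod_hom_eq[OF G(1) X(1) grp hom_compose[OF hs ht] hs _ _ that])
      (simp_all add: ev hG hX G(4,5) X(4,5))
  moreover have "(fp_map G X sG sX \<circ> fp_map G X tG tX) A = fp_map G X tG tX A"
    if "A \<in> carrier (free_prod G X)" for A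
    by (rule free_prod_hom_eq[OF G(1) X(1) grp hom_compose[OF ht hs] ht _ _ that])
      (simp_all add: ev hG hX G(4,5) X(4,5))
  ultimately show ?thesis
    using grp hs ht by simp
qed


subsection \<open>Quotients by the commutator of the two kernels\<close>

lemma commutator_trivial:
  assumes P: "group P" and H: "group H" and h: "h \<in> hom P H"
    and K: "K \<subseteq> carrier P" and L: "L \<subseteq> carrier P"
    and triv: "\<And>x y. x \<in> K \<Longrightarrow> y \<in> L \<Longrightarrow>
      h x \<otimes>\<^bsub>H\<^esub> h y \<otimes>\<^bsub>H\<^esub> inv\<^bsub>H\<^esub> h x \<otimes>\<^bsub>H\<^esub> inv\<^bsub>H\<^esub> h y = \<one>\<^bsub>H\<^esub>"
  shows "commutator_subgroup P K L \<subseteq> kernel P H h"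
proof -
  interpret group_hom P H h
    using P H h by (simp add: group_hom_def group_hom_axioms_def)
  have "{x \<otimes>\<^bsub>P\<^esub> y \<otimes>\<^bsub>P\<^esub> inv\<^bsub>P\<^esub> x \<otimes>\<^bsub>P\<^esub> inv\<^bsub>P\<^esub> y | x y. x \<in> K \<and> y \<in> L} \<subseteq> kernel P H h"
  proof
    fix z
    assume "z \<in> {x \<otimes>\<^bsub>P\<^esub> y \<otimes>\<^bsub>P\<^esub> inv\<^bsub>P\<^esub> x \<otimes>\<^bsub>P\<^esub> inv\<^bsub>P\<^esub> y | x y. x \<in> K \<and> y \<in> L}"
    then obtain x y where z: "z = x \<otimes>\<^bsub>P\<^esub> y \<otimes>\<^bsub>P\<^esub> inv\<^bsub>P\<^esub> x \<otimes>\<^bsub>P\<^esub> inv\<^bsub>P\<^esub> y" and xy: "x \<in> K" "y \<in> L"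
      by blast
    then have "x \<in> carrier P" "y \<in> carrier P"
      using K L by blast+
    then show "z \<in> kernel P H h"
      using triv[OF xy] by (simp add: z kernel_def)
  qed
  then show ?thesis
    unfolding commutator_subgroup_def by (rule G.generate_subgroup_incl[OF _ subgroup_kernel])
qed

lemma commutator_normal:
  assumes K: "K \<lhd> P" and L: "L \<lhd> P"
  shows "commutator_subgroup P K L \<lhd> P"
proof -
  interpret K: normal K P by (rule K)
  interpret L: normal L P by (rule L)
  show ?thesis
    unfolding commutator_subgroup_def
  proof (rule K.normal_generateI)
    show "{x \<otimes>\<^bsub>P\<^esub> y \<otimes>\<^bsub>P\<^esub> inv\<^bsub>P\<^esub> x \<otimes>\<^bsub>P\<^esub> inv\<^bsub>P\<^esub> y | x y. x \<in> K \<and> y \<in> L} \<subseteq> carrier P"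
      by auto
  next
    fix z g
    assume "z \<in> {x \<otimes>\<^bsub>P\<^esub> y \<otimes>\<^bsub>P\<^esub> inv\<^bsub>P\<^esub> x \<otimes>\<^bsub>P\<^esub> inv\<^bsub>P\<^esub> y | x y. x \<in> K \<and> y \<in> L}"
      and g: "g \<in> carrier P"
    then obtain x y where z: "z = x \<otimes>\<^bsub>P\<^esub> y \<otimes>\<^bsub>P\<^esub> inv\<^bsub>P\<^esub> x \<otimes>\<^bsub>P\<^esub> inv\<^bsub>P\<^esub> y" and xy: "x \<in> K" "y \<in> L"
      by blast
    let ?x = "g \<otimes>\<^bsub>P\<^esub> x \<otimes>\<^bsub>P\<^esub> inv\<^bsub>P\<^esub> g" and ?y = "g \<otimes>\<^bsub>P\<^esub> y \<otimes>\<^bsub>P\<^esub> inv\<^bsub>P\<^esub> g"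
    have c: "inv\<^bsub>P\<^esub> u \<otimes>\<^bsub>P\<^esub> (u \<otimes>\<^bsub>P\<^esub> v) = v" if "u \<in> carrier P" "v \<in> carrier P" for u v
      using that by (simp flip: K.m_assoc)
    have "g \<otimes>\<^bsub>P\<^esub> z \<otimes>\<^bsub>P\<^esub> inv\<^bsub>P\<^esub> g = ?x \<otimes>\<^bsub>P\<^esub> ?y \<otimes>\<^bsub>P\<^esub> inv\<^bsub>P\<^esub> ?x \<otimes>\<^bsub>P\<^esub> inv\<^bsub>P\<^esub> ?y"
      using g xy by (simp add: z K.m_assoc K.inv_mult_group c)
    moreover have "?x \<in> K" "?y \<in> L"
      using g xy by (simp_all add: K.inv_op_closed2 L.inv_op_closed2)
    ultimately show "g \<otimes>\<^bsub>P\<^esub> z \<otimes>\<^bsub>P\<^esub> inv\<^bsub>P\<^esub> g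
        \<in> {x \<otimes>\<^bsub>P\<^esub> y \<otimes>\<^bsub>P\<^esub> inv\<^bsub>P\<^esub> x \<otimes>\<^bsub>P\<^esub> inv\<^bsub>P\<^esub> y | x y. x \<in> K \<and> y \<in> L}"
      by blast
  qed
qed

lemma class_lift_rcoset:
  assumes N: "N \<lhd> P" and H: "group H" and h: "h \<in> hom P H" and NK: "N \<subseteq> kernel P H h"
    and a: "a \<in> carrier P"
  shows "class_lift h (N #>\<^bsub>P\<^esub> a) = h a"
proof -
  interpret N: normal N P by (rule N)
  interpret group_hom P H h
    using N.is_group H h by (simp add: group_hom_def group_hom_axioms_def)
  have "h b = h a" if b: "b \<in> N #>\<^bsub>P\<^esub> a" for b
  proof -
    obtain n where "n \<in> N" "b = n \<otimes>\<^bsub>P\<^esub> a"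
      using b by (auto simp: r_coset_def)
    moreover have "n \<in> carrier P" "h n = \<one>\<^bsub>H\<^esub>"
      using NK \<open>n \<in> N\<close> by (auto simp: kernel_def)
    ultimately show ?thesis using a by simp
  qed
  then have "h ` (N #>\<^bsub>P\<^esub> a) = (\<lambda>_. h a) ` (N #>\<^bsub>P\<^esub> a)"
    by (intro image_cong HOL.refl)
  also have "\<dots> = {h a}"
    using N.rcos_self[OF a N.subgroup_axioms] by (rule image_constant)
  finally have "h ` (N #>\<^bsub>P\<^esub> a) = {h a}" .
  then show ?thesis by (simp add: class_lift_def)
qed

lemma class_lift_hom:
  assumes N: "N \<lhd> P" and H: "group H" and h: "h \<in> hom P H" and NK: "N \<subseteq> kernel P H h"
  shows "class_lift h \<in> hom (P Mod N) H"
proof (rule homI)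
  interpret N: normal N P by (rule N)
  note [simp] = class_lift_rcoset[OF assms]
  show "class_lift h A \<in> carrier H" if "A \<in> carrier (P Mod N)" for A
    using that h by (auto simp: carrier_FactGroup hom_in_carrier)
  show "class_lift h (A \<otimes>\<^bsub>P Mod N\<^esub> B) = class_lift h A \<otimes>\<^bsub>H\<^esub> class_lift h B"
    if "A \<in> carrier (P Mod N)" "B \<in> carrier (P Mod N)" for A B
    using that h by (auto simp: carrier_FactGroup N.rcos_sum hom_mult)
qed

context
  fixes P :: "'a monoid" and s t :: "'a \<Rightarrow> 'a" and N :: "'a set" and sb tb :: "'a set \<Rightarrow> 'a set"
  assumes pre: "precrossed_module (P, s, t)"
  defines "N \<equiv> peiffer (P, s, t)"
    and "sb \<equiv> class_lift (\<lambda>a. peiffer (P, s, t) #>\<^bsub>P\<^esub> s a)"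
    and "tb \<equiv> class_lift (\<lambda>a. peiffer (P, s, t) #>\<^bsub>P\<^esub> t a)"
begin

lemma peiffer_quot_facts:
  shows peiffer_normal: "N \<lhd> P"
    and peiffer_quot_s: "a \<in> carrier P \<Longrightarrow> sb (N #>\<^bsub>P\<^esub> a) = N #>\<^bsub>P\<^esub> s a"
    and peiffer_quot_t: "a \<in> carrier P \<Longrightarrow> tb (N #>\<^bsub>P\<^esub> a) = N #>\<^bsub>P\<^esub> t a"
    and peiffer_quot_s_hom: "sb \<in> hom (P Mod N) (P Mod N)"
    and peiffer_quot_t_hom: "tb \<in> hom (P Mod N) (P Mod N)"
proof -
  have P: "group P" and s: "s \<in> hom P P" and t: "t \<in> hom P P"
    using pre by simp_all
  interpret s: group_hom P P s
    using P s by (simp add: group_hom_def group_hom_axioms_def)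
  interpret t: group_hom P P t
    using P t by (simp add: group_hom_def group_hom_axioms_def)
  show N: "N \<lhd> P"
    unfolding N_def peiffer.simps by (rule commutator_normal[OF s.normal_kernel t.normal_kernel])
  interpret N: normal N P by (rule N)
  have ks: "kernel P P s \<subseteq> carrier P" and kt: "kernel P P t \<subseteq> carrier P"
    by (auto simp: kernel_def)
  have "N \<subseteq> kernel P P s" "N \<subseteq> kernel P P t"
    unfolding N_def peiffer.simps
    by (rule commutator_trivial[OF P P _ ks kt]; auto simp: kernel_def s t)+
  then have ns: "s n = \<one>\<^bsub>P\<^esub>" and nt: "t n = \<one>\<^bsub>P\<^esub>" if "n \<in> N" for n
    using that unfolding kernel_def by blast+
  have ks: "N \<subseteq> kernel P (P Mod N) (\<lambda>a. N #>\<^bsub>P\<^esub> s a)"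
    and kt: "N \<subseteq> kernel P (P Mod N) (\<lambda>a. N #>\<^bsub>P\<^esub> t a)"
    by (rule subsetI; simp add: kernel_def ns nt s.G.coset_mult_one[OF N.subset])+
  have hs: "(\<lambda>a. N #>\<^bsub>P\<^esub> s a) \<in> hom P (P Mod N)" and ht: "(\<lambda>a. N #>\<^bsub>P\<^esub> t a) \<in> hom P (P Mod N)"
    using hom_compose[OF s N.r_coset_hom_Mod] hom_compose[OF t N.r_coset_hom_Mod]
    by (simp_all add: comp_def)
  note Q = N.factorgroup_is_group
  show "sb \<in> hom (P Mod N) (P Mod N)"
    unfolding sb_def N_def[symmetric] by (rule class_lift_hom[OF N Q hs ks])
  show "tb \<in> hom (P Mod N) (P Mod N)"
    unfolding tb_def N_def[symmetric] by (rule class_lift_hom[OF N Q ht kt])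
  show "sb (N #>\<^bsub>P\<^esub> a) = N #>\<^bsub>P\<^esub> s a" if "a \<in> carrier P"
    unfolding sb_def N_def[symmetric] by (rule class_lift_rcoset[OF N Q hs ks that])
  show "tb (N #>\<^bsub>P\<^esub> a) = N #>\<^bsub>P\<^esub> t a" if "a \<in> carrier P"
    unfolding tb_def N_def[symmetric] by (rule class_lift_rcoset[OF N Q ht kt that])
qed

lemma peiffer_quot_crossed: "crossed_module (P Mod N, sb, tb)"
proof -
  have P: "group P" and s: "s \<in> hom P P" and t: "t \<in> hom P P"
    and ts: "\<And>x. x \<in> carrier P \<Longrightarrow> t (s x) = s x" and st: "\<And>x. x \<in> carrier P \<Longrightarrow> s (t x) = t x"
    using pre by simp_all
  interpret s: group_hom P P s
    using P s by (simp add: group_hom_def group_hom_axioms_def)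
  interpret t: group_hom P P t
    using P t by (simp add: group_hom_def group_hom_axioms_def)
  interpret N: normal N P by (rule peiffer_normal)
  have Q: "group (P Mod N)" by (rule N.factorgroup_is_group)
  interpret Q: group "P Mod N" by (rule Q)
  interpret q: group_hom P "P Mod N" "\<lambda>a. N #>\<^bsub>P\<^esub> a"
    by unfold_locales (rule N.r_coset_hom_Mod)
  have cs: "s a \<in> carrier P" and ct: "t a \<in> carrier P" if "a \<in> carrier P" for a
    using that by simp_all
  have "precrossed_module (P Mod N, sb, tb)"
    using Q peiffer_quot_s_hom peiffer_quot_t_hom
    by (auto simp: carrier_FactGroup peiffer_quot_s peiffer_quot_t ts st)
  moreover have "commutator_subgroup (P Mod N) (kernel (P Mod N) (P Mod N) sb)
      (kernel (P Mod N) (P Mod N) tb) = {\<one>\<^bsub>P Mod N\<^esub>}"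
  proof -
    have ss: "s (s x) = s x" and tt: "t (t x) = t x" if "x \<in> carrier P" for x
      using ts[of x] st[of x] ts[of "t x"] st[of "s x"] that cs ct by simp_all
    have "commutator_subgroup (P Mod N) (kernel (P Mod N) (P Mod N) sb)
      (kernel (P Mod N) (P Mod N) tb) \<subseteq> kernel (P Mod N) (P Mod N) (\<lambda>x. x)"
    proof (rule commutator_trivial[OF Q Q])
      fix A B
      assume A: "A \<in> kernel (P Mod N) (P Mod N) sb" and B: "B \<in> kernel (P Mod N) (P Mod N) tb"
      obtain a where a: "a \<in> carrier P" "A = N #>\<^bsub>P\<^esub> a" "N #>\<^bsub>P\<^esub> s a = \<one>\<^bsub>P Mod N\<^esub>"
      proof -
        obtain a where "a \<in> carrier P" "A = N #>\<^bsub>P\<^esub> a"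
          using A unfolding kernel_def carrier_FactGroup by blast
        moreover have "sb A = \<one>\<^bsub>P Mod N\<^esub>"
          using A by (simp add: kernel_def)
        ultimately show thesis
          using that peiffer_quot_s by simp
      qed
      obtain b where b: "b \<in> carrier P" "B = N #>\<^bsub>P\<^esub> b" "N #>\<^bsub>P\<^esub> t b = \<one>\<^bsub>P Mod N\<^esub>"
      proof -
        obtain b where "b \<in> carrier P" "B = N #>\<^bsub>P\<^esub> b"
          using B unfolding kernel_def carrier_FactGroup by blast
        moreover have "tb B = \<one>\<^bsub>P Mod N\<^esub>"
          using B by (simp add: kernel_def)
        ultimately show thesis
          using that peiffer_quot_t by simp
      qed
      define a' where "a' = a \<otimes>\<^bsub>P\<^esub> inv\<^bsub>P\<^esub> s a"
      define b' where "b' = b \<otimes>\<^bsub>P\<^esub> inv\<^bsub>P\<^esub> t b"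
      have ab: "a' \<in> carrier P" "b' \<in> carrier P"
        using a b by (simp_all add: a'_def b'_def)
      have "a' \<in> kernel P P s" "b' \<in> kernel P P t"
        using a b by (simp_all add: a'_def b'_def kernel_def ss tt)
      then have "a' \<otimes>\<^bsub>P\<^esub> b' \<otimes>\<^bsub>P\<^esub> inv\<^bsub>P\<^esub> a' \<otimes>\<^bsub>P\<^esub> inv\<^bsub>P\<^esub> b' \<in> N"
        unfolding N_def peiffer.simps commutator_subgroup_def by (blast intro: generate.incl)
      then have n: "N #>\<^bsub>P\<^esub> (a' \<otimes>\<^bsub>P\<^esub> b' \<otimes>\<^bsub>P\<^esub> inv\<^bsub>P\<^esub> a' \<otimes>\<^bsub>P\<^esub> inv\<^bsub>P\<^esub> b') = \<one>\<^bsub>P Mod N\<^esub>"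
        by (simp add: N.rcos_const)
      have "N #>\<^bsub>P\<^esub> a' = (N #>\<^bsub>P\<^esub> a) \<otimes>\<^bsub>P Mod N\<^esub> inv\<^bsub>P Mod N\<^esub> (N #>\<^bsub>P\<^esub> s a)"
        using a(1) q.hom_mult[of a "inv\<^bsub>P\<^esub> s a"] q.hom_inv[of "s a"] by (simp add: a'_def)
      also have "\<dots> = A"
        unfolding a(3) using a(2) q.hom_closed[OF a(1)] Q.r_one Q.inv_one by metis
      finally have A': "A = N #>\<^bsub>P\<^esub> a'" ..
      have "N #>\<^bsub>P\<^esub> b' = (N #>\<^bsub>P\<^esub> b) \<otimes>\<^bsub>P Mod N\<^esub> inv\<^bsub>P Mod N\<^esub> (N #>\<^bsub>P\<^esub> t b)"
        using b(1) q.hom_mult[of b "inv\<^bsub>P\<^esub> t b"] q.hom_inv[of "t b"] by (simp add: b'_def)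
      also have "\<dots> = B"
        unfolding b(3) using b(2) q.hom_closed[OF b(1)] Q.r_one Q.inv_one by metis
      finally have B': "B = N #>\<^bsub>P\<^esub> b'" ..
      have "N #>\<^bsub>P\<^esub> (a' \<otimes>\<^bsub>P\<^esub> b' \<otimes>\<^bsub>P\<^esub> inv\<^bsub>P\<^esub> a' \<otimes>\<^bsub>P\<^esub> inv\<^bsub>P\<^esub> b') =
          A \<otimes>\<^bsub>P Mod N\<^esub> B \<otimes>\<^bsub>P Mod N\<^esub> inv\<^bsub>P Mod N\<^esub> A \<otimes>\<^bsub>P Mod N\<^esub> inv\<^bsub>P Mod N\<^esub> B"
        unfolding A' B' using ab
        by (simp only: q.hom_mult q.hom_inv s.G.m_closed s.G.inv_closed)
      with n show "A \<otimes>\<^bsub>P Mod N\<^esub> B \<otimes>\<^bsub>P Mod N\<^esub> inv\<^bsub>P Mod N\<^esub> A \<otimes>\<^bsub>P Mod N\<^esub> inv\<^bsub>P Mod N\<^esub> B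
          = \<one>\<^bsub>P Mod N\<^esub>"
        by metis
    qed (auto simp: kernel_def hom_def)
    moreover have "\<one>\<^bsub>P Mod N\<^esub> \<in> commutator_subgroup (P Mod N) (kernel (P Mod N) (P Mod N) sb)
      (kernel (P Mod N) (P Mod N) tb)"
      unfolding commutator_subgroup_def by (rule generate.one)
    ultimately show ?thesis
      unfolding kernel_def by blast
  qed
  ultimately show ?thesis by simp
qed

end

lemma xmod_hom_peiffer:
  assumes pre: "precrossed_module (P, s, t)" and Z: "crossed_module (H, s', t')"
    and h: "h \<in> xmod_hom (P, s, t) (H, s', t')"
  shows "peiffer (P, s, t) \<subseteq> kernel P H h"
proof -
  have P: "group P" and H: "group H" and hh: "h \<in> hom P H"
    using pre Z h by simp_all
  interpret group_hom P H h
    using P H hh by (simp add: group_hom_def group_hom_axioms_def)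
  have Zc: "commutator_subgroup H (kernel H H s') (kernel H H t') = {\<one>\<^bsub>H\<^esub>}"
    using Z by simp
  have hst: "s' (h x) = h (s x) \<and> t' (h x) = h (t x)" if "x \<in> carrier P" for x
    using h that by simp
  show ?thesis
    unfolding peiffer.simps
  proof (rule commutator_trivial[OF P H hh])
    fix x y
    assume x: "x \<in> kernel P P s" and y: "y \<in> kernel P P t"
    have "s' (h x) = \<one>\<^bsub>H\<^esub>" "t' (h y) = \<one>\<^bsub>H\<^esub>"
      using x y hst[of x] hst[of y] by (simp_all add: kernel_def)
    then have "h x \<in> kernel H H s'" "h y \<in> kernel H H t'"
      using x y by (simp_all add: kernel_def)
    then have "h x \<otimes>\<^bsub>H\<^esub> h y \<otimes>\<^bsub>H\<^esub> inv\<^bsub>H\<^esub> h x \<otimes>\<^bsub>H\<^esub> inv\<^bsub>H\<^esub> h y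
        \<in> commutator_subgroup H (kernel H H s') (kernel H H t')"
      unfolding commutator_subgroup_def by (blast intro: generate.incl)
    with Zc show "h x \<otimes>\<^bsub>H\<^esub> h y \<otimes>\<^bsub>H\<^esub> inv\<^bsub>H\<^esub> h x \<otimes>\<^bsub>H\<^esub> inv\<^bsub>H\<^esub> h y = \<one>\<^bsub>H\<^esub>"
      by simp
  qed (auto simp: kernel_def)
qed


subsection \<open>The coproduct\<close>

definition xmod_inl :: "'a gtriple \<Rightarrow> 'b gtriple \<Rightarrow> 'a \<Rightarrow> ('a + 'b) list set set" where
  "xmod_inl A B a =
     peiffer (precrossed_coprod A B) #>\<^bsub>free_prod (fst A) (fst B)\<^esub> fp_inl (fst A) (fst B) a"

definition xmod_inr :: "'a gtriple \<Rightarrow> 'b gtriple \<Rightarrow> 'b \<Rightarrow> ('a + 'b) list set set" where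
  "xmod_inr A B b =
     peiffer (precrossed_coprod A B) #>\<^bsub>free_prod (fst A) (fst B)\<^esub> fp_inr (fst A) (fst B) b"

lemma copair_xmod_hom:
  assumes A: "precrossed_module (G, sG, tG)" and B: "precrossed_module (X, sX, tX)"
    and Z: "precrossed_module (H, s, t)"
    and f: "f \<in> xmod_hom (G, sG, tG) (H, s, t)" and g: "g \<in> xmod_hom (X, sX, tX) (H, s, t)"
  shows "copair H f g \<in> xmod_hom (precrossed_coprod (G, sG, tG) (X, sX, tX)) (H, s, t)"
proof -
  have G: "group G" and sG: "sG \<in> hom G G" and tG: "tG \<in> hom G G"
    and X: "group X" and sX: "sX \<in> hom X X" and tX: "tX \<in> hom X X"
    and H: "group H" and s: "s \<in> hom H H" and t: "t \<in> hom H H"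
    using A B Z by simp_all
  have fh: "f \<in> hom G H" and gh: "g \<in> hom X H"
    and fst: "\<And>a. a \<in> carrier G \<Longrightarrow> f (sG a) = s (f a) \<and> f (tG a) = t (f a)"
    and gst: "\<And>x. x \<in> carrier X \<Longrightarrow> g (sX x) = s (g x) \<and> g (tX x) = t (g x)"
    using f g by simp_all
  note c = copair_hom[OF G X H fh gh]
  note cev = copair_inl[OF G X H fh gh] copair_inr[OF G X H fh gh]
  note mem = hom_in_carrier[OF sG] hom_in_carrier[OF sX] hom_in_carrier[OF tG] hom_in_carrier[OF tX]
  note ms = fp_map_hom[OF G X sG sX] and mt = fp_map_hom[OF G X tG tX]
  note ev = fp_map_inl[OF G X sG sX] fp_map_inr[OF G X sG sX]
    fp_map_inl[OF G X tG tX] fp_map_inr[OF G X tG tX]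
  have "(copair H f g \<circ> fp_map G X sG sX) w = (s \<circ> copair H f g) w"
    if "w \<in> carrier (free_prod G X)" for w
    by (rule free_prod_hom_eq[OF G X H hom_compose[OF ms c] hom_compose[OF c s] _ _ that])
      (simp_all add: ev cev mem fst gst)
  moreover have "(copair H f g \<circ> fp_map G X tG tX) w = (t \<circ> copair H f g) w"
    if "w \<in> carrier (free_prod G X)" for w
    by (rule free_prod_hom_eq[OF G X H hom_compose[OF mt c] hom_compose[OF c t] _ _ that])
      (simp_all add: ev cev mem fst gst)
  ultimately show ?thesis
    using c by simp
qed

theorem xmod_coprod_is_coproduct:
  fixes G :: "'a monoid" and X :: "'b monoid"
  assumes A: "crossed_module (G, sG, tG)" and B: "crossed_module (X, sX, tX)"
  shows "is_xmod_coproduct TYPE('z) (G, sG, tG) (X, sX, tX)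
    (xmod_coprod (G, sG, tG) (X, sX, tX))
    (xmod_inl (G, sG, tG) (X, sX, tX)) (xmod_inr (G, sG, tG) (X, sX, tX))"
proof -
  have pA: "precrossed_module (G, sG, tG)" and pB: "precrossed_module (X, sX, tX)"
    using A B by simp_all
  have G: "group G" and sG: "sG \<in> hom G G" and tG: "tG \<in> hom G G"
    and X: "group X" and sX: "sX \<in> hom X X" and tX: "tX \<in> hom X X"
    using pA pB by simp_all
  define P s t where "P = free_prod G X" and "s = fp_map G X sG sX" and "t = fp_map G X tG tX"
  define N where "N = peiffer (P, s, t)"
  define sb tb where "sb = class_lift (\<lambda>a. N #>\<^bsub>P\<^esub> s a)" and "tb = class_lift (\<lambda>a. N #>\<^bsub>P\<^esub> t a)"
  have pc: "precrossed_coprod (G, sG, tG) (X, sX, tX) = (P, s, t)"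
    by (simp add: P_def s_def t_def)
  have C: "xmod_coprod (G, sG, tG) (X, sX, tX) = (P Mod N, sb, tb)"
    unfolding xmod_coprod_def pc by (simp add: N_def sb_def tb_def)
  have i: "xmod_inl (G, sG, tG) (X, sX, tX) = (\<lambda>a. N #>\<^bsub>P\<^esub> fp_inl G X a)"
    and j: "xmod_inr (G, sG, tG) (X, sX, tX) = (\<lambda>x. N #>\<^bsub>P\<^esub> fp_inr G X x)"
    unfolding xmod_inl_def xmod_inr_def pc by (simp_all add: N_def P_def fun_eq_iff)
  have pre: "precrossed_module (P, s, t)"
    using precrossed_module_coprod[OF pA pB] unfolding pc .
  note facts = peiffer_quot_facts[OF pre, folded N_def, folded sb_def tb_def]
  have cm: "crossed_module (P Mod N, sb, tb)"
    using peiffer_quot_crossed[OF pre] unfolding N_def sb_def tb_def .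
  interpret N: normal N P by (rule facts(1))
  have li: "fp_inl G X \<in> hom G P" and ri: "fp_inr G X \<in> hom X P"
    unfolding P_def by (rule fp_inl_hom[OF G X] fp_inr_hom[OF G X])+
  note ev = fp_map_inl[OF G X sG sX, folded s_def] fp_map_inr[OF G X sG sX, folded s_def]
    fp_map_inl[OF G X tG tX, folded t_def] fp_map_inr[OF G X tG tX, folded t_def]
  have "(\<lambda>a. N #>\<^bsub>P\<^esub> fp_inl G X a) \<in> xmod_hom (G, sG, tG) (P Mod N, sb, tb)"
    using hom_compose[OF li N.r_coset_hom_Mod] hom_in_carrier[OF li]
    by (simp add: comp_def facts ev)
  moreover have "(\<lambda>x. N #>\<^bsub>P\<^esub> fp_inr G X x) \<in> xmod_hom (X, sX, tX) (P Mod N, sb, tb)"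
    using hom_compose[OF ri N.r_coset_hom_Mod] hom_in_carrier[OF ri]
    by (simp add: comp_def facts ev)
  moreover have "\<exists>u\<in>xmod_hom (P Mod N, sb, tb) Z.
      (\<forall>a\<in>carrier G. u (N #>\<^bsub>P\<^esub> fp_inl G X a) = f a) \<and>
      (\<forall>x\<in>carrier X. u (N #>\<^bsub>P\<^esub> fp_inr G X x) = g x) \<and>
      (\<forall>v\<in>xmod_hom (P Mod N, sb, tb) Z.
         (\<forall>a\<in>carrier G. v (N #>\<^bsub>P\<^esub> fp_inl G X a) = f a) \<longrightarrow>
         (\<forall>x\<in>carrier X. v (N #>\<^bsub>P\<^esub> fp_inr G X x) = g x) \<longrightarrow>
         (\<forall>c\<in>carrier (P Mod N). v c = u c))"
    if Z: "crossed_module Z" and f: "f \<in> xmod_hom (G, sG, tG) Z" and g: "g \<in> xmod_hom (X, sX, tX) Z"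
    for Z :: "'z gtriple" and f g
  proof -
    obtain H s' t' where Zeq: "Z = (H, s', t')" by (rule prod_cases3)
    have H: "group H" and pZ: "precrossed_module (H, s', t')"
      using Z by (simp_all add: Zeq)
    have fh: "f \<in> hom G H" and gh: "g \<in> hom X H"
      using f g by (simp_all add: Zeq)
    define h where "h = copair H f g"
    have h: "h \<in> xmod_hom (P, s, t) (H, s', t')"
      using copair_xmod_hom[OF pA pB pZ f[unfolded Zeq] g[unfolded Zeq]] unfolding h_def pc .
    then have hh: "h \<in> hom P H"
      and hst: "\<And>a. a \<in> carrier P \<Longrightarrow> h (s a) = s' (h a) \<and> h (t a) = t' (h a)" by simp_all
    have hN: "N \<subseteq> kernel P H h"
      unfolding N_def by (rule xmod_hom_peiffer[OF pre Z[unfolded Zeq] h])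
    note lift = class_lift_rcoset[OF facts(1) H hh hN]
    have sc: "s a \<in> carrier P" "t a \<in> carrier P" if "a \<in> carrier P" for a
      using pre that hom_in_carrier[of s P P a] hom_in_carrier[of t P P a] by simp_all
    have u: "class_lift h \<in> xmod_hom (P Mod N, sb, tb) Z"
      unfolding Zeq using class_lift_hom[OF facts(1) H hh hN]
      by (auto simp: carrier_FactGroup facts lift sc hst)
    have ui: "class_lift h (N #>\<^bsub>P\<^esub> fp_inl G X a) = f a" if "a \<in> carrier G" for a
      using that lift[OF hom_in_carrier[OF li that]] by (simp add: h_def copair_inl[OF G X H fh gh])
    have uj: "class_lift h (N #>\<^bsub>P\<^esub> fp_inr G X x) = g x" if "x \<in> carrier X" for x
      using that lift[OF hom_in_carrier[OF ri that]] by (simp add: h_def copair_inr[OF G X H fh gh])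
    have "v c = class_lift h c"
      if v: "v \<in> xmod_hom (P Mod N, sb, tb) Z"
        and vi: "\<forall>a\<in>carrier G. v (N #>\<^bsub>P\<^esub> fp_inl G X a) = f a"
        and vj: "\<forall>x\<in>carrier X. v (N #>\<^bsub>P\<^esub> fp_inr G X x) = g x"
        and c: "c \<in> carrier (P Mod N)" for v c
    proof -
      obtain a where a: "a \<in> carrier P" "c = N #>\<^bsub>P\<^esub> a"
        using c unfolding carrier_FactGroup by blast
      have vh: "v \<in> hom (P Mod N) H"
        using v by (simp add: Zeq)
      have vq: "v \<circ> (\<lambda>a. N #>\<^bsub>P\<^esub> a) \<in> hom (free_prod G X) H"
        using hom_compose[OF N.r_coset_hom_Mod vh] by (simp add: P_def)
      have "(v \<circ> (\<lambda>a. N #>\<^bsub>P\<^esub> a)) a = h a"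
        unfolding h_def
        by (rule free_prod_hom_eq[OF G X H vq copair_hom[OF G X H fh gh] _ _ a(1)[unfolded P_def]])
          (simp_all add: vi vj copair_inl[OF G X H fh gh] copair_inr[OF G X H fh gh])
      then show ?thesis using a lift by simp
    qed
    with u ui uj show ?thesis by blast
  qed
  ultimately show ?thesis
    unfolding is_xmod_coproduct_def C i j using A B cm by simp
qed

end

theory Submission
  imports Defs
begin

text \<open>
  The inclusion of crossed modules into precrossed modules has the Peiffer quotient
  \<open>P \<mapsto> P / [Ker s, Ker t]\<close> as left adjoint, and the statement is an instance of how this reflector
  treats a morphism \<open>\<phi> : P \<rightarrow> B\<close> with crossed codomain.  Such a \<open>\<phi>\<close> sends \<open>[Ker s, Ker t]\<close>
  into the corresponding commutator of \<open>B\<close>, which is trivial.  So the Peiffer subgroup \<open>N\<close> lies in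
  \<open>Ker \<phi>\<close> and \<open>\<phi>\<close> factors through \<open>P / N\<close>; for \<open>P = G + X\<close> and \<open>\<phi> = \<langle>f, 1\<rangle>\<close> this gives
  the induced morphism on the coproduct of crossed modules.

  Two observations finish the proof.  First, a coset of \<open>N\<close> is in the kernel of the factorisation
  exactly when it is a coset of an element of \<open>Ker \<phi>\<close>, so \<open>Ker \<phi> / N\<close> is literally the
  kernel of the induced homomorphism, as a subgroup of \<open>P / N\<close>
  (\<open>kernel_Mod_eq_kernel_class_lift\<close>).  Second, kernels of crossed modules are computed on
  underlying groups: the group-theoretic kernel is closed under \<open>s\<close> and \<open>t\<close>, it inherits the
  Peiffer condition because its commutators are commutators of the ambient crossed module, and any
  morphism killed by \<open>\<phi>\<close> takes its values there (\<open>restricted_kernel_is_xmod_kernel\<close>).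
\<close>

text \<open>
  Cosets of \<open>N\<close> and their products are formed with the multiplication alone, so restricting the
  carrier of \<open>P\<close> to the kernel only restricts the set of cosets.
\<close>

lemma kernel_Mod_eq_kernel_class_lift:
  assumes N: "N \<lhd> P" and H: "group H" and h: "h \<in> hom P H" and NK: "N \<subseteq> kernel P H h"
  shows "P\<lparr>carrier := kernel P H h\<rparr> Mod N =
    (P Mod N)\<lparr>carrier := kernel (P Mod N) H (class_lift h)\<rparr>"
proof -
  have "(\<lambda>a. N #>\<^bsub>P\<^esub> a) ` kernel P H h = kernel (P Mod N) H (class_lift h)"
    using class_lift_rcoset[OF assms] by (auto simp: kernel_def carrier_FactGroup)
  then show ?thesis
    by (simp add: FactGroup_def RCOSETS_def r_coset_def set_mult_def fun_eq_iff UNION_singleton_eq_range)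
qed

lemma xmod_hom_kernel_closed:
  assumes B: "precrossed_module (B, s', t')" and \<phi>: "\<phi> \<in> xmod_hom (A, s, t) (B, s', t')"
    and s: "s \<in> hom A A" and t: "t \<in> hom A A" and a: "a \<in> kernel A B \<phi>"
  shows "s a \<in> kernel A B \<phi>" and "t a \<in> kernel A B \<phi>"
proof -
  have "group B" "s' \<in> hom B B" "t' \<in> hom B B"
    using B by simp_all
  then have "s' \<one>\<^bsub>B\<^esub> = \<one>\<^bsub>B\<^esub>" "t' \<one>\<^bsub>B\<^esub> = \<one>\<^bsub>B\<^esub>"
    by (simp_all add: hom_one)
  then show "s a \<in> kernel A B \<phi>" "t a \<in> kernel A B \<phi>"
    using \<phi> a hom_in_carrier[OF s] hom_in_carrier[OF t] by (simp_all add: kernel_def)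
qed

text \<open>
  The endomorphisms are cut down with \<open>restrict\<close>, hence are unspecified outside the kernel; all
  conditions on crossed modules and their morphisms only look at elements of the carrier.
\<close>

lemma restricted_kernel_crossed_module:
  assumes A: "crossed_module (A, s, t)" and B: "precrossed_module (B, s', t')"
    and \<phi>: "\<phi> \<in> xmod_hom (A, s, t) (B, s', t')"
  defines "L \<equiv> kernel A B \<phi>"
  shows "crossed_module (A\<lparr>carrier := L\<rparr>, restrict s L, restrict t L)"
proof -
  let ?K = "A\<lparr>carrier := L\<rparr>"
  have gA: "group A" and gB: "group B" and \<phi>h: "\<phi> \<in> hom A B"
    and s: "s \<in> hom A A" and t: "t \<in> hom A A"
    and ts: "\<And>x. x \<in> carrier A \<Longrightarrow> t (s x) = s x" and st: "\<And>x. x \<in> carrier A \<Longrightarrow> s (t x) = t x"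
    and triv: "commutator_subgroup A (kernel A A s) (kernel A A t) = {\<one>\<^bsub>A\<^esub>}"
    using A B \<phi> by simp_all
  interpret \<phi>: group_hom A B \<phi>
    using gA gB \<phi>h by (simp add: group_hom_def group_hom_axioms_def)
  have sub: "subgroup L A"
    unfolding L_def by (rule \<phi>.subgroup_kernel)
  then have gK: "group ?K"
    by (rule \<phi>.G.subgroup_imp_group)
  have LA: "x \<in> carrier A" if "x \<in> L" for x
    using that by (simp add: L_def kernel_def)
  have cl: "s x \<in> L" "t x \<in> L" if "x \<in> L" for x
    using xmod_hom_kernel_closed[OF B \<phi> s t] that by (simp_all add: L_def)
  have mL: "x \<otimes>\<^bsub>A\<^esub> y \<in> L" if "x \<in> L" "y \<in> L" for x y
    using sub that by (rule subgroup.m_closed)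
  have "precrossed_module (?K, restrict s L, restrict t L)"
    using gK cl mL LA ts st hom_mult[OF s] hom_mult[OF t]
    by (auto intro!: homI)
  moreover have "commutator_subgroup ?K (kernel ?K ?K (restrict s L)) (kernel ?K ?K (restrict t L))
      = {\<one>\<^bsub>?K\<^esub>}"
  proof -
    have incl: "(\<lambda>x. x) \<in> hom ?K A"
      using LA by (auto intro!: homI)
    have "commutator_subgroup ?K (kernel ?K ?K (restrict s L)) (kernel ?K ?K (restrict t L))
        \<subseteq> kernel ?K A (\<lambda>x. x)"
      \<comment> \<open>Testing the commutators along the inclusion into \<open>A\<close> means that their inverses are the
        inverses of \<open>A\<close>, so that the Peiffer condition of \<open>A\<close> applies to them directly.\<close>
    proof (rule commutator_trivial[OF gK gA incl])
      fix x y
      assume "x \<in> kernel ?K ?K (restrict s L)" "y \<in> kernel ?K ?K (restrict t L)"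
      then have "x \<in> kernel A A s" "y \<in> kernel A A t"
        using LA by (auto simp: kernel_def)
      then have "x \<otimes>\<^bsub>A\<^esub> y \<otimes>\<^bsub>A\<^esub> inv\<^bsub>A\<^esub> x \<otimes>\<^bsub>A\<^esub> inv\<^bsub>A\<^esub> y
          \<in> commutator_subgroup A (kernel A A s) (kernel A A t)"
        unfolding commutator_subgroup_def by (blast intro: generate.incl)
      with triv show "x \<otimes>\<^bsub>A\<^esub> y \<otimes>\<^bsub>A\<^esub> inv\<^bsub>A\<^esub> x \<otimes>\<^bsub>A\<^esub> inv\<^bsub>A\<^esub> y = \<one>\<^bsub>A\<^esub>"
        by simp
    qed (auto simp: kernel_def)
    moreover have "\<one>\<^bsub>?K\<^esub> \<in> commutator_subgroup ?K (kernel ?K ?K (restrict s L))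
        (kernel ?K ?K (restrict t L))"
      unfolding commutator_subgroup_def by (rule generate.one)
    moreover have "kernel ?K A (\<lambda>x. x) \<subseteq> {\<one>\<^bsub>?K\<^esub>}"
      by (auto simp: kernel_def)
    ultimately show ?thesis by blast
  qed
  ultimately show ?thesis by simp
qed

text \<open>
  The mediating morphism is the test morphism itself with its codomain narrowed; since the kernel
  map is an inclusion, uniqueness is immediate.
\<close>

lemma restricted_kernel_is_xmod_kernel:
  assumes A: "crossed_module (A, s, t)" and B: "crossed_module (B, s', t')"
    and \<phi>: "\<phi> \<in> xmod_hom (A, s, t) (B, s', t')"
  defines "L \<equiv> kernel A B \<phi>"
  shows "is_xmod_kernel TYPE('z) (A, s, t) (B, s', t') \<phi>
    (A\<lparr>carrier := L\<rparr>, restrict s L, restrict t L) (\<lambda>x. x)"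
proof -
  let ?K = "(A\<lparr>carrier := L\<rparr>, restrict s L, restrict t L)"
  have pB: "precrossed_module (B, s', t')"
    using B by simp
  have K: "crossed_module ?K"
    unfolding L_def by (rule restricted_kernel_crossed_module[OF A pB \<phi>])
  have L: "x \<in> L \<longleftrightarrow> x \<in> carrier A \<and> \<phi> x = \<one>\<^bsub>B\<^esub>" for x
    by (simp add: L_def kernel_def)
  have k: "(\<lambda>x. x) \<in> xmod_hom ?K (A, s, t)"
    by (auto simp: L intro!: homI)
  have u: "h \<in> xmod_hom Z ?K"
    if Z: "crossed_module Z" and h: "h \<in> xmod_hom Z (A, s, t)"
      and triv: "\<forall>z\<in>carrier (fst Z). \<phi> (h z) = \<one>\<^bsub>B\<^esub>"
    for Z :: "'z gtriple" and h
  proof -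
    obtain H r w where Zeq: "Z = (H, r, w)" by (rule prod_cases3)
    have h': "h \<in> hom H A" "\<And>z. z \<in> carrier H \<Longrightarrow> h (r z) = s (h z) \<and> h (w z) = t (h z)"
      using h by (simp_all add: Zeq)
    have "h z \<in> L" if "z \<in> carrier H" for z
      using triv that hom_in_carrier[OF h'(1) that] by (simp add: L Zeq)
    then show ?thesis
      using h'(2) hom_mult[OF h'(1)] by (auto simp: Zeq intro!: homI)
  qed
  have "\<exists>u\<in>xmod_hom Z ?K. (\<forall>z\<in>carrier (fst Z). u z = h z) \<and>
      (\<forall>v\<in>xmod_hom Z ?K. (\<forall>z\<in>carrier (fst Z). v z = h z) \<longrightarrow> (\<forall>z\<in>carrier (fst Z). v z = u z))"
    if "crossed_module Z" "h \<in> xmod_hom Z (A, s, t)" "\<forall>z\<in>carrier (fst Z). \<phi> (h z) = \<one>\<^bsub>B\<^esub>"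
    for Z :: "'z gtriple" and h
    using u[OF that] by (intro bexI[of _ h]) simp_all
  with A B \<phi> K k show ?thesis
    unfolding is_xmod_kernel_def by (simp add: L)
qed

lemma class_lift_peiffer_quot_xmod_hom:
  assumes pre: "precrossed_module (P, s, t)" and B: "crossed_module (B, s', t')"
    and \<phi>: "\<phi> \<in> xmod_hom (P, s, t) (B, s', t')"
  shows "class_lift \<phi> \<in> xmod_hom (peiffer_quot (P, s, t)) (B, s', t')"
proof -
  have gB: "group B" and \<phi>h: "\<phi> \<in> hom P B"
    and comm: "\<And>a. a \<in> carrier P \<Longrightarrow> \<phi> (s a) = s' (\<phi> a) \<and> \<phi> (t a) = t' (\<phi> a)"
    and s: "s \<in> hom P P" and t: "t \<in> hom P P"
    using pre B \<phi> by simp_all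
  note facts = peiffer_quot_facts[OF pre]
  note NK = xmod_hom_peiffer[OF pre B \<phi>]
  note lift = class_lift_rcoset[OF facts(1) gB \<phi>h NK]
  show ?thesis
    using class_lift_hom[OF facts(1) gB \<phi>h NK] hom_in_carrier[OF s] hom_in_carrier[OF t]
    by (auto simp del: peiffer.simps simp: carrier_FactGroup facts lift comm)
qed

text \<open>
  Because the codomain is crossed, the Peiffer subgroup already lies in the kernel, so dividing it
  out commutes with forming the kernel.
\<close>

lemma peiffer_quot_kernel:
  assumes pre: "precrossed_module (P, s, t)" and B: "crossed_module (B, s', t')"
    and \<phi>: "\<phi> \<in> xmod_hom (P, s, t) (B, s', t')"
    and Q: "peiffer_quot (P, s, t) = (Q, sb, tb)"
  defines "N \<equiv> peiffer (P, s, t)"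
  defines "K \<equiv> P\<lparr>carrier := kernel P B \<phi>\<rparr> Mod N"
  shows "N \<lhd> P\<lparr>carrier := kernel P B \<phi>\<rparr>"
    and "is_xmod_kernel TYPE('z) (Q, sb, tb) (B, s', t') (class_lift \<phi>)
      (K, restrict sb (carrier K), restrict tb (carrier K)) (\<lambda>A. A)"
proof -
  have gP: "group P" and gB: "group B" and \<phi>h: "\<phi> \<in> hom P B"
    using pre B \<phi> by simp_all
  interpret \<phi>: group_hom P B \<phi>
    using gP gB \<phi>h by (simp add: group_hom_def group_hom_axioms_def)
  have N: "N \<lhd> P"
    unfolding N_def by (rule peiffer_normal[OF pre])
  have NK: "N \<subseteq> kernel P B \<phi>"
    unfolding N_def by (rule xmod_hom_peiffer[OF pre B \<phi>])
  show "N \<lhd> P\<lparr>carrier := kernel P B \<phi>\<rparr>"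
    by (rule \<phi>.G.normal_restrict_supergroup[OF \<phi>.subgroup_kernel N NK])
  have "Q = P Mod N"
    using Q by (simp add: N_def)
  then have "K = Q\<lparr>carrier := kernel Q B (class_lift \<phi>)\<rparr>"
    unfolding K_def using kernel_Mod_eq_kernel_class_lift[OF N gB \<phi>h NK] by simp
  moreover have "crossed_module (Q, sb, tb)"
    using peiffer_quot_crossed[OF pre] unfolding peiffer_quot.simps[symmetric] Q .
  moreover have "class_lift \<phi> \<in> xmod_hom (Q, sb, tb) (B, s', t')"
    using class_lift_peiffer_quot_xmod_hom[OF pre B \<phi>] by (simp only: Q)
  ultimately show "is_xmod_kernel TYPE('z) (Q, sb, tb) (B, s', t') (class_lift \<phi>)
      (K, restrict sb (carrier K), restrict tb (carrier K)) (\<lambda>A. A)"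
    using restricted_kernel_is_xmod_kernel[OF _ B] by simp
qed

theorem theorem4p8:
  fixes G :: "'g monoid" and sG tG :: "'g \<Rightarrow> 'g"
    and X :: "'x monoid" and sX tX :: "'x \<Rightarrow> 'x"
    and f :: "'g \<Rightarrow> 'x"
  assumes "crossed_module (G, sG, tG)"
    and "crossed_module (X, sX, tX)"
    and "xmod_coprod (G, sG, tG) (X, sX, tX) = (C, s_bar, t_bar)"
    and "f \<in> xmod_hom (G, sG, tG) (X, sX, tX)"
  defines "P \<equiv> free_prod G X"
    and "\<phi> \<equiv> copair X f (\<lambda>x. x)"
  defines "N \<equiv> commutator_subgroup P
      (kernel P P (fp_map G X sG sX)) (kernel P P (fp_map G X tG tX))"
  defines "K \<equiv> P\<lparr>carrier := kernel P X \<phi>\<rparr> Mod N"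
  shows "N \<lhd> P\<lparr>carrier := kernel P X \<phi>\<rparr> \<and>
    is_xmod_kernel TYPE('z) (C, s_bar, t_bar) (X, sX, tX) (class_lift \<phi>)
      (K, restrict s_bar (carrier K), restrict t_bar (carrier K)) (\<lambda>A. A)"
proof -
  let ?s = "fp_map G X sG sX" and ?t = "fp_map G X tG tX"
  have pG: "precrossed_module (G, sG, tG)" and pX: "precrossed_module (X, sX, tX)"
    using assms(1,2) by simp_all
  have id: "(\<lambda>x. x) \<in> xmod_hom (X, sX, tX) (X, sX, tX)"
    by (auto intro: homI)
  have pre: "precrossed_module (P, ?s, ?t)"
    using precrossed_module_coprod[OF pG pX] by (simp add: P_def)
  have \<phi>: "\<phi> \<in> xmod_hom (P, ?s, ?t) (X, sX, tX)"
    using copair_xmod_hom[OF pG pX pX assms(4) id] by (simp add: P_def \<phi>_def)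
  have Q: "peiffer_quot (P, ?s, ?t) = (C, s_bar, t_bar)"
    using assms(3) by (simp add: xmod_coprod_def P_def)
  show ?thesis
    using peiffer_quot_kernel[OF pre assms(2) \<phi> Q] by (simp add: N_def K_def)
qed

end
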